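(* The operator $\Diamond$ cannot be defined in terms of $\Box$ over the class of finite expanding models: there is no formula $\varphi\in\mathcal L_{\Box}$ such that $\Diamond p\leftrightarrow\varphi$ is valid over the class of all finite models based on dynamic posets (with $p$ a propositional variable).
   Context: Formulas of $\mathcal L$ are generated by $\varphi::=p\mid\bot\mid\varphi\wedge\varphi\mid\varphi\vee\varphi\mid\varphi\to\varphi\mid\bigcirc\varphi\mid\Diamond\varphi\mid\Box\varphi\mid\varphi\,\mathcal U\,\varphi\mid\varphi\,\mathcal R\,\varphi$ over a countable set of propositional variables; $\varphi\leftrightarrow\psi:=(\varphi\to\psi)\wedge(\psi\to\varphi)$. $\mathcal L_{\Box}$ is the fragment built from variables, $\bot,\wedge,\vee,\to,\bigcirc,\Box$ only. A dynamic poset is $(W,\preccurlyeq,S)$ with $W\ne\emptyset$, $\preccurlyeq$ a partial order, $S:W\to W$ with $w\preccurlyeq v\Rightarrow S(w)\preccurlyeq S(v)$. An (expanding) model is $(W,\preccurlyeq,S,V)$ with $(W,\preccurlyeq,S)$ a dynamic poset and $V$ assigning to each world a set of variables, with $w\preccurlyeq v\Rightarrow V(w)\subseteq V(v)$; it is finite if $W$ is finite. Satisfaction: $w\models p$ iff $p\in V(w)$; $w\not\models\bot$; $\wedge,\vee$ classical; $w\models\varphi\to\psi$ iff for all $v\succcurlyeq w$, $v\models\varphi$ implies $v\models\psi$; $w\models\bigcirc\varphi$ iff $S(w)\models\varphi$; $w\models\Diamond\varphi$ iff $\exists k\ge0$, $S^k(w)\models\varphi$; $w\models\Box\varphi$ iff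 $\forall k\ge0$, $S^k(w)\models\varphi$. Valid over a class means true at every world of every model in the class. *)

theory Defs
  imports "HOL-Library.Countable" "HOL-Library.FuncSet"
begin

datatype 'v formula =
    Var 'v
  | Falsum
  | And "'v formula" "'v formula"
  | Or "'v formula" "'v formula"
  | Imp "'v formula" "'v formula"
  | Next "'v formula"
  | Diamond "'v formula"
  | Box "'v formula"
  | Until "'v formula" "'v formula"
  | Release "'v formula" "'v formula"

definition Iff :: "'v formula \<Rightarrow> 'v formula \<Rightarrow> 'v formula" where
  "Iff \<phi> \<psi> = And (Imp \<phi> \<psi>) (Imp \<psi> \<phi>)"

inductive_set box_fragment :: "'v formula set" where
  "Var q \<in> box_fragment"
| "Falsum \<in> box_fragment"
| "\<phi> \<in> box_fragment \<Longrightarrow> \<psi> \<in> box_fragment \<Longrightarrow> And \<phi> \<psi> \<in> box_fragment"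
| "\<phi> \<in> box_fragment \<Longrightarrow> \<psi> \<in> box_fragment \<Longrightarrow> Or \<phi> \<psi> \<in> box_fragment"
| "\<phi> \<in> box_fragment \<Longrightarrow> \<psi> \<in> box_fragment \<Longrightarrow> Imp \<phi> \<psi> \<in> box_fragment"
| "\<phi> \<in> box_fragment \<Longrightarrow> Next \<phi> \<in> box_fragment"
| "\<phi> \<in> box_fragment \<Longrightarrow> Box \<phi> \<in> box_fragment"

record 'w dynamic_poset =
  worlds :: "'w set"
  order :: "'w rel"
  step :: "'w \<Rightarrow> 'w"

record ('w, 'v) model = "'w dynamic_poset" +
  val :: "'w \<Rightarrow> 'v set"

definition is_dynamic_poset :: "('w, 'm) dynamic_poset_scheme \<Rightarrow> bool" where
  "is_dynamic_poset F \<longleftrightarrow>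
     worlds F \<noteq> {} \<and>
     partial_order_on (worlds F) (order F) \<and>
     step F \<in> worlds F \<rightarrow> worlds F \<and>
     (\<forall>w v. (w, v) \<in> order F \<longrightarrow> (step F w, step F v) \<in> order F)"

definition expanding_models :: "('w, 'v) model set" where
  "expanding_models =
     {M. is_dynamic_poset M \<and> (\<forall>w v. (w, v) \<in> order M \<longrightarrow> val M w \<subseteq> val M v)}"

definition finite_expanding_models :: "('w, 'v) model set" where
  "finite_expanding_models = {M \<in> expanding_models. finite (worlds M)}"

primrec sat :: "('w, 'v) model \<Rightarrow> 'w \<Rightarrow> 'v formula \<Rightarrow> bool" where
  "sat M w (Var q) \<longleftrightarrow> q \<in> val M w"
| "sat M w Falsum \<longleftrightarrow> False"
| "sat M w (And \<phi> \<psi>) \<longleftrightarrow> sat M w \<phi> \<and> sat M w \<psi>"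
| "sat M w (Or \<phi> \<psi>) \<longleftrightarrow> sat M w \<phi> \<or> sat M w \<psi>"
| "sat M w (Imp \<phi> \<psi>) \<longleftrightarrow> (\<forall>v. (w, v) \<in> order M \<longrightarrow> sat M v \<phi> \<longrightarrow> sat M v \<psi>)"
| "sat M w (Next \<phi>) \<longleftrightarrow> sat M (step M w) \<phi>"
| "sat M w (Diamond \<phi>) \<longleftrightarrow> (\<exists>k. sat M ((step M ^^ k) w) \<phi>)"
| "sat M w (Box \<phi>) \<longleftrightarrow> (\<forall>k. sat M ((step M ^^ k) w) \<phi>)"
| "sat M w (Until \<phi> \<psi>) \<longleftrightarrow>
     (\<exists>k. sat M ((step M ^^ k) w) \<psi> \<and> (\<forall>i<k. sat M ((step M ^^ i) w) \<phi>))"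
| "sat M w (Release \<phi> \<psi>) \<longleftrightarrow>
     (\<forall>k. sat M ((step M ^^ k) w) \<psi> \<or> (\<exists>i<k. sat M ((step M ^^ i) w) \<phi>))"

definition valid_over :: "('w, 'v) model set \<Rightarrow> 'v formula \<Rightarrow> bool" where
  "valid_over C \<phi> \<longleftrightarrow> (\<forall>M\<in>C. \<forall>w\<in>worlds M. sat M w \<phi>)"

text \<open>
  HOL cannot quantify over world types inside a formula. The lemma
  \<open>finite_valid_transfer\<close> below shows that nothing is lost by taking the worlds of finite
  models to be natural numbers: validity over those models implies validity over the
  finite models with worlds in any type.
\<close>

definition image_model :: "('a \<Rightarrow> 'b) \<Rightarrow> ('a, 'v) model \<Rightarrow> ('b, 'v) model" where
  "image_model f M =
     \<lparr>worlds = f ` worlds M, order = map_prod f f ` order M,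
      step = (\<lambda>x. f (step M (inv_into (worlds M) f x))),
      val = (\<lambda>x. val M (inv_into (worlds M) f x))\<rparr>"

lemma sat_image_model:
  assumes M: "is_dynamic_poset M" and f: "inj_on f (worlds M)" and w: "w \<in> worlds M"
  shows "sat (image_model f M) (f w) \<phi> \<longleftrightarrow> sat M w \<phi>"
proof -
  let ?N = "image_model f M"
  have inv: "inv_into (worlds M) f (f x) = x" if "x \<in> worlds M" for x
    using f that by simp
  have st: "step M x \<in> worlds M" if "x \<in> worlds M" for x
    using M that by (auto simp: is_dynamic_poset_def)
  have stn: "(step M ^^ k) x \<in> worlds M" if "x \<in> worlds M" for x k
    by (induction k) (use that st in auto)
  have pw: "(step ?N ^^ k) (f x) = f ((step M ^^ k) x)" if "x \<in> worlds M" for x k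
    by (induction k) (use that stn inv in \<open>auto simp: image_model_def\<close>)
  have ow: "x \<in> worlds M \<and> y \<in> worlds M" if "(x, y) \<in> order M" for x y
    using M that by (auto simp: is_dynamic_poset_def partial_order_on_def preorder_on_def)
  have ord: "(f x, z) \<in> order ?N \<longleftrightarrow> (\<exists>y. z = f y \<and> (x, y) \<in> order M)"
    if "x \<in> worlds M" for x z
    using that ow inj_onD[OF f] by (fastforce simp: image_model_def)
  from w show ?thesis
  proof (induction \<phi> arbitrary: w)
    case (Var q)
    then show ?case by (simp add: image_model_def inv)
  next
    case (Imp \<phi> \<psi>)
    have "sat ?N (f w) (Imp \<phi> \<psi>) \<longleftrightarrow>
        (\<forall>y. (w, y) \<in> order M \<longrightarrow> sat ?N (f y) \<phi> \<longrightarrow> sat ?N (f y) \<psi>)"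
      using ord[OF Imp.prems] by auto
    also have "\<dots> \<longleftrightarrow> sat M w (Imp \<phi> \<psi>)"
      using Imp.IH ow by auto
    finally show ?case .
  next
    case (Next \<phi>)
    then show ?case using pw[of w 1] st by simp
  qed (simp_all add: pw stn)
qed

lemma image_model_finite_expanding:
  assumes M: "M \<in> finite_expanding_models" and f: "inj_on f (worlds M)"
  shows "image_model f M \<in> finite_expanding_models"
proof -
  have D: "is_dynamic_poset M" and F: "finite (worlds M)"
    and V: "\<And>x y. (x, y) \<in> order M \<Longrightarrow> val M x \<subseteq> val M y"
    using M by (auto simp: finite_expanding_models_def expanding_models_def)
  have sub: "order M \<subseteq> worlds M \<times> worlds M" and re: "refl_on (worlds M) (order M)"
    and tr: "trans (order M)" and an: "antisym (order M)"
    and ne: "worlds M \<noteq> {}" and st: "step M \<in> worlds M \<rightarrow> worlds M"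
    and mo: "\<And>x y. (x, y) \<in> order M \<Longrightarrow> (step M x, step M y) \<in> order M"
    using D by (auto simp: is_dynamic_poset_def partial_order_on_def preorder_on_def)
  let ?r = "map_prod f f ` order M"
  have inv: "inv_into (worlds M) f (f x) = x" if "x \<in> worlds M" for x
    using f that by simp
  have rD: "\<exists>x y. a = f x \<and> b = f y \<and> (x, y) \<in> order M" if "(a, b) \<in> ?r" for a b
    using that by auto
  have "?r \<subseteq> f ` worlds M \<times> f ` worlds M" using sub by auto
  moreover have "refl_on (f ` worlds M) ?r"
    using re by (force simp: refl_on_def)
  moreover have "trans ?r"
  proof (rule transI)
    fix a b c assume ab: "(a, b) \<in> ?r" and bc: "(b, c) \<in> ?r"
    from rD[OF ab] rD[OF bc] obtain x y y' z where *: "a = f x" "b = f y" "b = f y'" "c = f z"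
      "(x, y) \<in> order M" "(y', z) \<in> order M" by metis
    then have "y = y'" using sub inj_onD[OF f] by blast
    with * tr have "(x, z) \<in> order M" by (blast dest: transD)
    with * show "(a, c) \<in> ?r" by force
  qed
  moreover have "antisym ?r"
  proof (rule antisymI)
    fix a b assume ab: "(a, b) \<in> ?r" and ba: "(b, a) \<in> ?r"
    from rD[OF ab] rD[OF ba] obtain x y y' x' where *: "a = f x" "b = f y" "b = f y'" "a = f x'"
      "(x, y) \<in> order M" "(y', x') \<in> order M" by metis
    then have "y = y'" "x = x'" using sub inj_onD[OF f] by blast+
    with * an show "a = b" by (auto dest: antisymD)
  qed
  ultimately have "partial_order_on (f ` worlds M) ?r"
    by (auto simp: partial_order_on_def preorder_on_def)
  moreover have "(\<lambda>x. f (step M (inv_into (worlds M) f x))) \<in> f ` worlds M \<rightarrow> f ` worlds M"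
    using st inv by auto
  moreover have "(f (step M (inv_into (worlds M) f a)), f (step M (inv_into (worlds M) f b))) \<in> ?r
      \<and> val M (inv_into (worlds M) f a) \<subseteq> val M (inv_into (worlds M) f b)"
    if ab: "(a, b) \<in> ?r" for a b
  proof -
    obtain x y where xy: "a = f x" "b = f y" "(x, y) \<in> order M" using rD[OF ab] by blast
    then have "inv_into (worlds M) f a = x" "inv_into (worlds M) f b = y"
      using sub inv by auto
    then show ?thesis using mo[OF xy(3)] V[OF xy(3)] by force
  qed
  ultimately show ?thesis
    using ne F
    by (simp add: image_model_def finite_expanding_models_def expanding_models_def
        is_dynamic_poset_def)
qed

lemma finite_valid_transfer:
  fixes \<phi> :: "'v formula"
  assumes "valid_over (finite_expanding_models :: (nat, 'v) model set) \<phi>"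
  shows "valid_over (finite_expanding_models :: ('w, 'v) model set) \<phi>"
  unfolding valid_over_def
proof (intro ballI)
  fix M :: "('w, 'v) model" and w
  assume M: "M \<in> finite_expanding_models" and w: "w \<in> worlds M"
  have D: "is_dynamic_poset M" and "finite (worlds M)"
    using M by (auto simp: finite_expanding_models_def expanding_models_def)
  then obtain f :: "'w \<Rightarrow> nat" where f: "inj_on f (worlds M)"
    using finite_imp_inj_to_nat_seg by blast
  have "sat (image_model f M) (f w) \<phi>"
    using assms image_model_finite_expanding[OF M f] w
    by (auto simp: valid_over_def image_model_def)
  then show "sat M w \<phi>" using sat_image_model[OF D f w] by simp
qed

end

(* On the chain N < N-1 < ... < 1 < 0 let every world i with i < N move one step up (0 stays put),
   let the root N be a fixed point, and let variables hold at 0 only. The step is inflationary, so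
   by persistence Box is redundant, while a Box-formula of size n cannot tell apart
   the worlds at distance more than n from 0. But Diamond p fails at N and holds at N - 1. *)
theory Submission
  imports Defs
begin

lemma order_funpow_step:
  assumes "is_dynamic_poset M" and "(w, v) \<in> order M"
  shows "((step M ^^ k) w, (step M ^^ k) v) \<in> order M"
  by (induction k) (use assms in \<open>auto simp: is_dynamic_poset_def\<close>)

text \<open>Induction on the formula: transitivity of the order settles implication, and for the
  temporal operators the orbits of \<open>w\<close> and \<open>v\<close> are compared at equal
  times, where monotonicity of \<open>step\<close> keeps them ordered.\<close>

lemma sat_persistent:
  assumes M: "M \<in> expanding_models" and "(w, v) \<in> order M" and "sat M w \<phi>"
  shows "sat M v \<phi>"
proof -
  have D: "is_dynamic_poset M" and V: "\<And>x y. (x, y) \<in> order M \<Longrightarrow> val M x \<subseteq> val M y"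
    using M by (auto simp: expanding_models_def)
  have tr: "trans (order M)"
    using D by (auto simp: is_dynamic_poset_def partial_order_on_def preorder_on_def)
  note pow = order_funpow_step[OF D]
  from assms(2,3) show ?thesis
  proof (induction \<phi> arbitrary: w v)
    case (Var q)
    then show ?case using V by auto
  next
    case (Imp \<phi> \<psi>)
    then show ?case using tr by (auto dest: transD)
  next
    case (Next \<phi>)
    then show ?case using pow[of w v 1] by auto
  next
    case (Diamond \<phi>)
    then show ?case using Diamond.IH[OF pow[OF Diamond.prems(1)]]
      unfolding sat.simps by blast
  next
    case (Box \<phi>)
    then show ?case using Box.IH[OF pow[OF Box.prems(1)]]
      unfolding sat.simps by blast
  next
    case (Until \<phi> \<psi>)
    then show ?case using Until.IH(1)[OF pow[OF Until.prems(1)]] Until.IH(2)[OF pow[OF Until.prems(1)]]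
      unfolding sat.simps by blast
  next
    case (Release \<phi> \<psi>)
    then show ?case using Release.IH(1)[OF pow[OF Release.prems(1)]] Release.IH(2)[OF pow[OF Release.prems(1)]]
      unfolding sat.simps by blast
  qed auto
qed

lemma sat_Box_inflationary:
  assumes M: "M \<in> expanding_models" and w: "w \<in> worlds M"
    and infl: "\<And>v. v \<in> worlds M \<Longrightarrow> (v, step M v) \<in> order M"
  shows "sat M w (Box \<phi>) \<longleftrightarrow> sat M w \<phi>"
proof
  assume "sat M w (Box \<phi>)"
  then have "sat M ((step M ^^ 0) w) \<phi>" unfolding sat.simps by blast
  then show "sat M w \<phi>" by simp
next
  assume *: "sat M w \<phi>"
  \<comment> \<open>Membership in \<open>worlds M\<close> is carried along because
    \<open>infl\<close> speaks of worlds only.\<close>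
  have "(step M ^^ k) w \<in> worlds M \<and> sat M ((step M ^^ k) w) \<phi>" for k
  proof (induction k)
    case (Suc k)
    then have "(step M ^^ Suc k) w \<in> worlds M"
      using M by (auto simp: expanding_models_def is_dynamic_poset_def)
    moreover have "sat M ((step M ^^ Suc k) w) \<phi>"
      using sat_persistent[OF M infl] Suc by simp
    ultimately show ?case ..
  qed (simp_all add: w *)
  then show "sat M w (Box \<phi>)" by simp
qed

text \<open>A world is numbered by its distance from the top, so the order reverses that of the
  numbers. Truncated subtraction makes \<open>0\<close> a fixed point, and fixing \<open>N\<close>
  keeps \<open>step\<close> monotone since \<open>N\<close> is the least world.\<close>

definition chain_model :: "nat \<Rightarrow> (nat, 'v) model" where
  "chain_model N =
     \<lparr>worlds = {..N}, order = {(i, j). j \<le> i \<and> i \<le> N},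
      step = (\<lambda>i. if i = N then N else i - 1),
      val = (\<lambda>i. if i = 0 then UNIV else {})\<rparr>"

lemma worlds_chain_model: "worlds (chain_model N) = {..N}"
  by (simp add: chain_model_def)

lemma chain_model_finite_expanding: "chain_model N \<in> finite_expanding_models"
  by (auto simp: chain_model_def finite_expanding_models_def expanding_models_def
      is_dynamic_poset_def partial_order_on_def preorder_on_def refl_on_def trans_def antisym_def)

lemma sat_chain_model_Box:
  assumes "i \<le> N"
  shows "sat (chain_model N) i (Box \<phi>) \<longleftrightarrow> sat (chain_model N) i \<phi>"
proof (rule sat_Box_inflationary)
  show "chain_model N \<in> expanding_models"
    using chain_model_finite_expanding by (auto simp: finite_expanding_models_def)
qed (use assms in \<open>auto simp: chain_model_def\<close>)

text \<open>The strict bound keeps \<open>i\<close> and \<open>j\<close> away from \<open>0\<close>,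
  the only world where variables hold, and leaves room for one step down at each
  \<open>Next\<close>.\<close>

lemma sat_chain_model_eq:
  assumes "\<phi> \<in> box_fragment" and "size \<phi> < i" "i \<le> N" and "size \<phi> < j" "j \<le> N"
  shows "sat (chain_model N) i \<phi> \<longleftrightarrow> sat (chain_model N) j \<phi>"
  using assms
proof (induction arbitrary: i j rule: box_fragment.induct)
  case (1 q)
  then show ?case by (simp add: chain_model_def)
next
  case (3 \<phi> \<psi>)
  show ?case using "3.IH"(1)[of i j] "3.IH"(2)[of i j] "3.prems" by simp
next
  case (4 \<phi> \<psi>)
  show ?case using "4.IH"(1)[of i j] "4.IH"(2)[of i j] "4.prems" by simp
next
  case (5 \<phi> \<psi>)
  \<comment> \<open>By symmetry in \<open>i\<close> and \<open>j\<close> one direction is enough. A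
    world \<open>k\<close> above \<open>j\<close> is either above \<open>i\<close> as well, or has a
    number larger than \<open>i\<close>; then the induction hypotheses give it the same truth values
    as \<open>i\<close> for both subformulas.\<close>
  have "sat (chain_model N) j (Imp \<phi> \<psi>)"
    if i: "size (Imp \<phi> \<psi>) < i" "i \<le> N" and j: "size (Imp \<phi> \<psi>) < j" "j \<le> N"
      and s: "sat (chain_model N) i (Imp \<phi> \<psi>)" for i j
  proof -
    have s': "sat (chain_model N) k \<phi> \<longrightarrow> sat (chain_model N) k \<psi>" if "k \<le> i" for k
      using s i that by (auto simp: chain_model_def)
    have "sat (chain_model N) k \<phi> \<longrightarrow> sat (chain_model N) k \<psi>" if "k \<le> j" for k
    proof (cases "k \<le> i")
      case False
      then show ?thesis using s'[of i] "5.IH"(1)[of k i] "5.IH"(2)[of k i] i j that by auto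
    qed (rule s')
    then show ?thesis by (auto simp: chain_model_def)
  qed
  then show ?case using "5.prems" by blast
next
  case (6 \<phi>)
  \<comment> \<open>A step lowers the number by at most one, and so does the bound when
    \<open>Next\<close> is removed.\<close>
  have "size \<phi> < step (chain_model N) k \<and> step (chain_model N) k \<le> N"
    if "size (Next \<phi>) < k" "k \<le> N" for k
    using that by (auto simp: chain_model_def)
  then show ?case unfolding sat.simps using "6.IH" "6.prems" by blast
next
  case (7 \<phi>)
  show ?case using "7.IH"[of i j] "7.prems" by (simp add: sat_chain_model_Box del: sat.simps)
qed simp_all

lemma not_sat_chain_model_Diamond:
  assumes "0 < N"
  shows "\<not> sat (chain_model N) N (Diamond (Var p))"
proof -
  have "(step (chain_model N) ^^ k) N = N" for k
    by (induction k) (simp_all add: chain_model_def)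
  then show ?thesis using assms by (simp add: chain_model_def)
qed

lemma sat_chain_model_Diamond:
  assumes "i < N"
  shows "sat (chain_model N) i (Diamond (Var p))"
proof -
  \<comment> \<open>The numbers on the orbit never exceed \<open>i\<close>, so the exceptional
    clause at \<open>N\<close> is not met.\<close>
  have "(step (chain_model N) ^^ k) i = i - k" for k
    by (induction k) (use assms in \<open>auto simp: chain_model_def\<close>)
  then have "sat (chain_model N) ((step (chain_model N) ^^ i) i) (Var p)"
    by (simp add: chain_model_def)
  then show ?thesis unfolding sat.simps by blast
qed

theorem mainTheorem3:
  fixes p :: "'v :: countable"
  shows "\<not> (\<exists>\<phi> \<in> box_fragment.
    valid_over (finite_expanding_models :: (nat, 'v) model set) (Iff (Diamond (Var p)) \<phi>))"
proof
  assume "\<exists>\<phi> \<in> box_fragment.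
    valid_over (finite_expanding_models :: (nat, 'v) model set) (Iff (Diamond (Var p)) \<phi>)"
  then obtain \<phi> where \<phi>: "\<phi> \<in> box_fragment"
    and valid: "valid_over (finite_expanding_models :: (nat, 'v) model set)
      (Iff (Diamond (Var p)) \<phi>)"
    by blast
  \<comment> \<open>The least choice for which both \<open>N - 1\<close> and \<open>N\<close> exceed
    \<open>size \<phi>\<close>.\<close>
  define N where "N = size \<phi> + 2"
  let ?M = "chain_model N :: (nat, 'v) model"
  have equiv: "sat ?M i (Diamond (Var p)) \<longleftrightarrow> sat ?M i \<phi>" if "i \<le> N" for i
  proof -
    have "sat ?M i (Iff (Diamond (Var p)) \<phi>)"
      using valid chain_model_finite_expanding that unfolding valid_over_def
      by (metis atMost_iff worlds_chain_model)
    \<comment> \<open>Evaluating both implications at \<open>i\<close> itself turns them into an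
      equivalence of truth values there.\<close>
    moreover have "(i, i) \<in> order ?M" using that by (simp add: chain_model_def)
    ultimately show ?thesis unfolding Iff_def sat.simps by blast
  qed
  have "sat ?M (N - 1) \<phi> \<longleftrightarrow> sat ?M N \<phi>"
    by (rule sat_chain_model_eq[OF \<phi>]) (simp_all add: N_def)
  moreover have "sat ?M (N - 1) (Diamond (Var p))"
    by (rule sat_chain_model_Diamond) (simp add: N_def)
  moreover have "\<not> sat ?M N (Diamond (Var p))"
    by (rule not_sat_chain_model_Diamond) (simp add: N_def)
  ultimately show False using equiv[of N] equiv[of "N - 1"] by simp
qed

end
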